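(* Let $\nu\colon\mathbb{R}_{>0}\times\mathbb{N}\to\mathbb{N}\cup\{0,\infty\}$ be monotone non-decreasing in the first argument. Let $\Gamma$ be a $\nu$-flexibly stable (resp. $\nu$-flexibly BS-rigid) group, and let $H$ be a finite-index subgroup of $\Gamma$. Then $H$ is $\nu'$-flexibly stable (resp. $\nu'$-flexibly BS-rigid) for $$\nu'(\varepsilon,n)=([\Gamma:H]-1)\,n+\nu(\varepsilon,[\Gamma:H]\,n).$$
   Context: Write $[n]=\{1,\dots,n\}$ and $\mathrm{Sym}(n)$ for the symmetric group on $[n]$. For $\sigma\in\mathrm{Sym}(n)$ and $\tau\in\mathrm{Sym}(M)$ with $M\ge n$, $d(\sigma,\tau)=d(\tau,\sigma)=\frac1n|\{x\in[n]\mid\sigma x\neq\tau x\}|$. For a group $\Gamma$, $f\colon\Gamma\to\mathrm{Sym}(n)$ and finite $Q\subset\Gamma$, $N_{f,Q}$ is the distribution on $2^Q$ of $\{\gamma\in Q\mid f(\gamma)x=x\}$ with $x$ uniform in $[n]$; $d_{\mathrm{TV}}$ is total variation distance (half the $\ell^1$ distance). Call a sequence of functions $(f_\ell\colon\Gamma\to\mathrm{Sym}(n_\ell))_{\ell=1}^\infty$ with $n_\ell\to\infty$ an asymptotic homomorphism if $d(f_\ell(\gamma_1\gamma_2),f_\ell(\gamma_1)f_\ell(\gamma_2))\to0$ for all $\gamma_1,\gamma_2\in\Gamma$. Call it $\nu$-correctable if there are positive reals $\varepsilon_\ell\to0$ and homomorphisms $(h_\ell\colon\Gamma\to\mathrm{Sym}(N_\ell))_{\ell=1}^\infty$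 with $n_\ell\le N_\ell\le n_\ell+\nu(\varepsilon_\ell,n_\ell)$ such that $d(f_\ell(\gamma),h_\ell(\gamma))\to0$ for all $\gamma\in\Gamma$. A group $\Gamma$ is $\nu$-flexibly stable if every asymptotic homomorphism is $\nu$-correctable. It is $\nu$-flexibly BS-rigid if every asymptotic homomorphism $(f_\ell)$ for which there exist homomorphisms $(g_\ell\colon\Gamma\to\mathrm{Sym}(n_\ell))_{\ell=1}^\infty$ with $d_{\mathrm{TV}}(N_{f_\ell,Q},N_{g_\ell,Q})\to0$ for every finite $Q\subset\Gamma$ is $\nu$-correctable. *)

theory Defs
  imports
    "HOL-Algebra.Sym_Groups"
    "HOL-Algebra.Coset"
    "HOL-Library.Extended_Nat"
    "HOL-Probability.Probability_Mass_Function"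
begin

text \<open>
  The symmetric group on \<open>[n] = {1..n}\<close> is the library's \<^const>\<open>sym_group\<close>. Its elements are
  functions on \<open>nat\<close> fixing everything outside \<open>{1..n}\<close>, so they do not determine the degree; the
  argument \<open>n\<close> below is the smaller of the degrees of the two permutations compared.
\<close>

definition perm_dist :: "nat \<Rightarrow> (nat \<Rightarrow> nat) \<Rightarrow> (nat \<Rightarrow> nat) \<Rightarrow> real" where
  "perm_dist n \<sigma> \<tau> = real (card {x \<in> {1..n}. \<sigma> x \<noteq> \<tau> x}) / real n"

text \<open>
  The distribution \<open>N\<^bsub>f,Q\<^esub>\<close> on subsets of \<open>Q\<close>, for \<open>n \<ge> 1\<close>
  (\<^const>\<open>pmf_of_set\<close> is only meaningful on nonempty finite sets).
\<close>

definition stab_pmf :: "nat \<Rightarrow> ('a \<Rightarrow> nat \<Rightarrow> nat) \<Rightarrow> 'a set \<Rightarrow> 'a set pmf" where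
  "stab_pmf n f Q = map_pmf (\<lambda>x. {\<gamma> \<in> Q. f \<gamma> x = x}) (pmf_of_set {1..n})"

text \<open>Total variation distance of two distributions on a finite set \<open>\<Omega>\<close>.\<close>

definition tv_dist :: "'b set \<Rightarrow> 'b pmf \<Rightarrow> 'b pmf \<Rightarrow> real" where
  "tv_dist \<Omega> p q = (\<Sum>s\<in>\<Omega>. \<bar>pmf p s - pmf q s\<bar>) / 2"

text \<open>
  Sequences are indexed by \<open>nat\<close> starting at \<open>0\<close>. The degrees \<open>n l\<close> are positive, since
  \<^const>\<open>perm_dist\<close> and \<^const>\<open>stab_pmf\<close> make no sense in degree \<open>0\<close>.
\<close>

definition asymptotic_hom ::
  "('a, 'b) monoid_scheme \<Rightarrow> (nat \<Rightarrow> nat) \<Rightarrow> (nat \<Rightarrow> 'a \<Rightarrow> nat \<Rightarrow> nat) \<Rightarrow> bool" where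
  "asymptotic_hom \<Gamma> n f \<longleftrightarrow>
     (\<forall>l. n l \<ge> 1) \<and> filterlim n at_top sequentially \<and>
     (\<forall>l. f l \<in> carrier \<Gamma> \<rightarrow> carrier (sym_group (n l))) \<and>
     (\<forall>\<gamma>\<^sub>1\<in>carrier \<Gamma>. \<forall>\<gamma>\<^sub>2\<in>carrier \<Gamma>.
        (\<lambda>l. perm_dist (n l) (f l (\<gamma>\<^sub>1 \<otimes>\<^bsub>\<Gamma>\<^esub> \<gamma>\<^sub>2))
               (f l \<gamma>\<^sub>1 \<otimes>\<^bsub>sym_group (n l)\<^esub> f l \<gamma>\<^sub>2)) \<longlonglongrightarrow> 0)"

text \<open>Only the values \<open>\<nu> \<epsilon> n\<close> with \<open>\<epsilon> > 0\<close> and \<open>n \<ge> 1\<close> are used.\<close>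

definition correctable ::
  "(real \<Rightarrow> nat \<Rightarrow> enat) \<Rightarrow> ('a, 'b) monoid_scheme \<Rightarrow> (nat \<Rightarrow> nat) \<Rightarrow> (nat \<Rightarrow> 'a \<Rightarrow> nat \<Rightarrow> nat) \<Rightarrow> bool"
  where
  "correctable \<nu> \<Gamma> n f \<longleftrightarrow>
     (\<exists>(\<epsilon> :: nat \<Rightarrow> real) (N :: nat \<Rightarrow> nat) h.
        (\<forall>l. \<epsilon> l > 0) \<and> \<epsilon> \<longlonglongrightarrow> 0 \<and>
        (\<forall>l. h l \<in> hom \<Gamma> (sym_group (N l))) \<and>
        (\<forall>l. n l \<le> N l \<and> enat (N l) \<le> enat (n l) + \<nu> (\<epsilon> l) (n l)) \<and>
        (\<forall>\<gamma>\<in>carrier \<Gamma>. (\<lambda>l. perm_dist (n l) (f l \<gamma>) (h l \<gamma>)) \<longlonglongrightarrow> 0))"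

definition flexibly_stable ::
  "(real \<Rightarrow> nat \<Rightarrow> enat) \<Rightarrow> ('a, 'b) monoid_scheme \<Rightarrow> bool" where
  "flexibly_stable \<nu> \<Gamma> \<longleftrightarrow> (\<forall>n f. asymptotic_hom \<Gamma> n f \<longrightarrow> correctable \<nu> \<Gamma> n f)"

definition flexibly_BS_rigid ::
  "(real \<Rightarrow> nat \<Rightarrow> enat) \<Rightarrow> ('a, 'b) monoid_scheme \<Rightarrow> bool" where
  "flexibly_BS_rigid \<nu> \<Gamma> \<longleftrightarrow>
     (\<forall>n f. asymptotic_hom \<Gamma> n f \<longrightarrow>
        (\<exists>g. (\<forall>l. g l \<in> hom \<Gamma> (sym_group (n l))) \<and>
             (\<forall>Q. finite Q \<and> Q \<subseteq> carrier \<Gamma> \<longrightarrow>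
                (\<lambda>l. tv_dist (Pow Q) (stab_pmf (n l) (f l) Q) (stab_pmf (n l) (g l) Q)) \<longlonglongrightarrow> 0)) \<longrightarrow>
        correctable \<nu> \<Gamma> n f)"

text \<open>Only meaningful for subgroups of finite index: \<^const>\<open>card\<close> is \<open>0\<close> on infinite sets.\<close>

definition group_index :: "('a, 'b) monoid_scheme \<Rightarrow> 'a set \<Rightarrow> nat" where
  "group_index \<Gamma> H = card (rcosets\<^bsub>\<Gamma>\<^esub> H)"

end

theory Submission
  imports Defs
begin

text \<open>
  Induce an asymptotic homomorphism of \<open>H\<close> in degree \<open>n\<close> to \<open>\<Gamma>\<close> in degree \<open>[\<Gamma>:H] n\<close>: for a left
  transversal \<open>t\<^sub>0 = 1, \<dots>, t\<^sub>k\<^sub>-\<^sub>1\<close> and \<open>\<gamma> t\<^sub>i = t\<^sub>j c\<close> with \<open>c \<in> H\<close>, let \<open>\<gamma>\<close> send \<open>(i, x)\<close> to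
  \<open>(j, f(c) x)\<close>. This preserves asymptotic multiplicativity and genuine homomorphisms. The stabiliser
  statistics of the induced map are averages over \<open>i\<close> of images of those of \<open>f\<close> on
  \<open>H \<inter> t\<^sub>i\<^sup>-\<^sup>1 Q t\<^sub>i\<close>, so closeness in total variation is preserved too. Restricting a correction of
  the induced map to \<open>H\<close> corrects \<open>f\<close>, since \<open>H\<close> acts on the block \<open>i = 0\<close> through \<open>f\<close>; the
  other \<open>k - 1\<close> blocks account for the extra term \<open>(k - 1) n\<close>.
\<close>

section \<open>Blocks of size \<open>n\<close> in \<open>{1..k * n}\<close>\<close>

lemma block_in_range:
  fixes i k n x :: nat
  assumes "i < k" "x \<in> {1..n}"
  shows "i * n + x \<in> {1..k * n}"
proof -
  have "(i + 1) * n \<le> k * n" using assms(1) by (intro mult_right_mono) auto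
  then show ?thesis using assms(2) by auto
qed

text \<open>Points are numbered from 1, so the last point of block \<open>i\<close> is
  \<open>i * n + n\<close>; subtracting 1 before dividing keeps it in block \<open>i\<close>, and
  adding 1 to the remainder restores the range \<open>{1..n}\<close>.\<close>

lemma block_coordinates:
  fixes i n x :: nat
  assumes "x \<in> {1..n}"
  shows "(i * n + x - 1) div n = i" "(i * n + x - 1) mod n + 1 = x"
proof -
  have e: "i * n + x - 1 = i * n + (x - 1)" and l: "x - 1 < n" using assms by auto
  show "(i * n + x - 1) div n = i" unfolding e using l by simp
  show "(i * n + x - 1) mod n + 1 = x" unfolding e mod_mult_self3 using l assms by simp
qed

lemma block_decomposition:
  fixes k n y :: nat
  assumes "y \<in> {1..k * n}"
  obtains i x where "i < k" "x \<in> {1..n}" "y = i * n + x"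
proof
  have n: "n > 0" using assms by (cases n) auto
  show "(y - 1) div n < k" using assms n by (intro less_mult_imp_div_less) auto
  show "(y - 1) mod n + 1 \<in> {1..n}" using n by (auto simp: Suc_le_eq)
  show "y = (y - 1) div n * n + ((y - 1) mod n + 1)" using assms by simp
qed

text \<open>Through this count, both the distances and the stabiliser statistics in degree
  \<open>k * n\<close> become averages over the \<open>k\<close> blocks.\<close>

lemma card_blocks:
  fixes k n :: nat
  shows "card {y \<in> {1..k * n}. P y} = (\<Sum>i<k. card {x \<in> {1..n}. P (i * n + x)})"
proof -
  let ?S = "SIGMA i:{..<k}. {x \<in> {1..n}. P (i * n + x)}"
  let ?e = "\<lambda>(i, x). i * n + x"
  have inj: "inj_on ?e ?S"
  proof (rule inj_onI, clarify)
    fix i x j x' assume "x \<in> {1..n}" "x' \<in> {1..n}" "i * n + x = j * n + x'"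
    then show "i = j \<and> x = x'"
      using block_coordinates[of x n i] block_coordinates[of x' n j] by metis
  qed
  have "?e ` ?S = {y \<in> {1..k * n}. P y}"
  proof
    show "?e ` ?S \<subseteq> {y \<in> {1..k * n}. P y}"
      using block_in_range[of _ k _ n] by fastforce
    show "{y \<in> {1..k * n}. P y} \<subseteq> ?e ` ?S"
    proof
      fix y assume y: "y \<in> {y \<in> {1..k * n}. P y}"
      then obtain i x where "i < k" "x \<in> {1..n}" "y = i * n + x"
        using block_decomposition by blast
      then show "y \<in> ?e ` ?S" using y by (intro image_eqI[of _ _ "(i, x)"]) auto
    qed
  qed
  then have "card {y \<in> {1..k * n}. P y} = card ?S"
    using card_image[OF inj] by simp
  then show ?thesis by simp
qed

section \<open>Induced maps\<close>

lemma homD_sym_group: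
  assumes "f \<in> hom G (sym_group n)"
  shows "f \<in> carrier G \<rightarrow> carrier (sym_group n)"
    and "\<And>a b. a \<in> carrier G \<Longrightarrow> b \<in> carrier G \<Longrightarrow> f (a \<otimes>\<^bsub>G\<^esub> b) = f a \<circ> f b"
  using assms by (auto simp: hom_def sym_group_mult)

text \<open>The condition \<open>inv (t i) \<otimes> g \<in> H\<close> says that \<open>g\<close>
  lies in the left coset \<open>t i H\<close>. Normalising \<open>t 0\<close> makes block 0 carry
  the original map on \<open>H\<close>.\<close>

locale left_transversal = group G for G (structure) +
  fixes H :: "'a set" and k :: nat and t :: "nat \<Rightarrow> 'a"
  assumes subgroup_H: "subgroup H G"
    and k_pos: "0 < k"
    and t_closed: "i < k \<Longrightarrow> t i \<in> carrier G"
    and t_0: "t 0 = \<one>"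
    and t_transversal: "g \<in> carrier G \<Longrightarrow> \<exists>!i. i < k \<and> inv (t i) \<otimes> g \<in> H"
begin

text \<open>This is the action of \<open>G\<close> on the left cosets of \<open>H\<close>, written
  on their indices.\<close>

definition shift :: "'a \<Rightarrow> nat \<Rightarrow> nat" where
  "shift g i = (THE j. j < k \<and> inv (t j) \<otimes> (g \<otimes> t i) \<in> H)"

definition cocycle :: "'a \<Rightarrow> nat \<Rightarrow> 'a" where
  "cocycle g i = inv (t (shift g i)) \<otimes> (g \<otimes> t i)"

text \<open>The pair \<open>(i, x)\<close> is encoded as \<open>i * n + x\<close>. When
  \<open>f\<close> is a homomorphism this is the usual induced permutation action. Points outside
  the range are fixed, as membership in \<open>sym_group\<close> demands.\<close>

definition induced :: "nat \<Rightarrow> ('a \<Rightarrow> nat \<Rightarrow> nat) \<Rightarrow> 'a \<Rightarrow> nat \<Rightarrow> nat" where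
  "induced n f g y =
     (if y \<in> {1..k * n}
      then shift g ((y - 1) div n) * n + f (cocycle g ((y - 1) div n)) ((y - 1) mod n + 1)
      else y)"

lemma H_closed: "h \<in> H \<Longrightarrow> h \<in> carrier G"
  using subgroup.subset[OF subgroup_H] by blast

lemma shift_cocycle:
  assumes "g \<in> carrier G" "i < k"
  shows shift_less: "shift g i < k" and cocycle_in: "cocycle g i \<in> H"
    and shift_eqI: "\<And>j. j < k \<Longrightarrow> inv (t j) \<otimes> (g \<otimes> t i) \<in> H \<Longrightarrow> shift g i = j"
proof -
  have ex: "\<exists>!j. j < k \<and> inv (t j) \<otimes> (g \<otimes> t i) \<in> H"
    using assms t_closed by (intro t_transversal) auto
  show "shift g i < k" "cocycle g i \<in> H"
    using theI'[OF ex] by (auto simp: shift_def cocycle_def)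
  show "shift g i = j" if "j < k" "inv (t j) \<otimes> (g \<otimes> t i) \<in> H" for j
    unfolding shift_def using the1_equality[OF ex] that by blast
qed

text \<open>Inserting \<open>t j \<otimes> inv (t j)\<close> between \<open>a\<close> and
  \<open>b\<close>, with \<open>j = shift b i\<close>, factors the conjugated product into two
  cocycle values. Their product lies in \<open>H\<close>, so uniqueness of the index determines the
  shift, and the cocycle identity follows.\<close>

lemma shift_cocycle_mult:
  assumes "a \<in> carrier G" "b \<in> carrier G" "i < k"
  shows shift_mult: "shift (a \<otimes> b) i = shift a (shift b i)"
    and cocycle_mult: "cocycle (a \<otimes> b) i = cocycle a (shift b i) \<otimes> cocycle b i"
proof -
  let ?j = "shift b i" and ?m = "shift a (shift b i)"
  have j: "?j < k" using shift_less assms by blast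
  have m: "?m < k" using shift_less assms j by blast
  have tc: "t i \<in> carrier G" "t ?j \<in> carrier G" "t ?m \<in> carrier G"
    using t_closed assms j m by auto
  have "t ?j \<otimes> (inv (t ?j) \<otimes> (b \<otimes> t i)) = b \<otimes> t i"
    using assms tc by (simp flip: m_assoc)
  then have eq: "inv (t ?m) \<otimes> (a \<otimes> b \<otimes> t i) = cocycle a ?j \<otimes> cocycle b i"
    using assms tc by (simp add: cocycle_def m_assoc)
  have "cocycle a ?j \<otimes> cocycle b i \<in> H"
    using cocycle_in assms j by (intro subgroup.m_closed[OF subgroup_H]) auto
  then show s: "shift (a \<otimes> b) i = ?m"
    using assms m eq by (intro shift_eqI) auto
  show "cocycle (a \<otimes> b) i = cocycle a ?j \<otimes> cocycle b i"
    using eq by (simp add: cocycle_def s)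
qed

lemma shift_one: "i < k \<Longrightarrow> shift \<one> i = i"
  using t_closed[of i] subgroup.one_closed[OF subgroup_H] by (intro shift_eqI) simp_all

lemma shift_inj:
  assumes "g \<in> carrier G" "i < k" "j < k" "shift g i = shift g j"
  shows "i = j"
proof -
  have *: "shift (inv g) (shift g m) = m" if "m < k" for m
    using shift_mult[OF inv_closed[OF assms(1)] assms(1) that]
    by (simp only: l_inv[OF assms(1)] shift_one[OF that])
  show ?thesis using *[OF assms(2)] *[OF assms(3)] unfolding assms(4) by (rule trans[OF sym])
qed

lemma shift_cocycle_subgroup:
  assumes "h \<in> H"
  shows shift_subgroup: "shift h 0 = 0" and cocycle_subgroup: "cocycle h 0 = h"
proof -
  have eq: "inv (t 0) \<otimes> (h \<otimes> t 0) = h" using H_closed[OF assms] by (simp add: t_0)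
  show s: "shift h 0 = 0"
    by (rule shift_eqI[OF H_closed[OF assms] k_pos k_pos]) (simp only: eq assms)
  show "cocycle h 0 = h" unfolding cocycle_def s by (rule eq)
qed

lemma shift_eq_self_iff:
  assumes "g \<in> carrier G" "i < k"
  shows "shift g i = i \<longleftrightarrow> inv (t i) \<otimes> (g \<otimes> t i) \<in> H"
proof
  assume "shift g i = i"
  then show "inv (t i) \<otimes> (g \<otimes> t i) \<in> H"
    using cocycle_in[OF assms] by (simp only: cocycle_def)
qed (rule shift_eqI[OF assms assms(2)])

lemma induced_block:
  assumes "i < k" "x \<in> {1..n}"
  shows "induced n f g (i * n + x) = shift g i * n + f (cocycle g i) x"
  by (simp only: induced_def block_in_range[OF assms] block_coordinates[OF assms(2)] if_True)

lemma cocycle_image: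
  assumes "f \<in> H \<rightarrow> carrier (sym_group n)" "g \<in> carrier G" "i < k" "x \<in> {1..n}"
  shows "f (cocycle g i) x \<in> {1..n}"
proof -
  have "f (cocycle g i) permutes {1..n}"
    using funcset_mem[OF assms(1) cocycle_in[OF assms(2,3)]] by (simp only: sym_group_carrier)
  then show ?thesis by (simp only: permutes_in_image assms(4))
qed

text \<open>Distinct blocks go to distinct blocks by \<open>shift_inj\<close>, and within block
  \<open>i\<close> the single permutation \<open>f (cocycle g i)\<close> acts. An injective self-map
  of a finite set is bijective.\<close>

lemma induced_permutes:
  assumes f: "f \<in> H \<rightarrow> carrier (sym_group n)" and g: "g \<in> carrier G"
  shows "induced n f g permutes {1..k * n}"
proof (rule bij_imp_permutes)
  have into: "induced n f g ` {1..k * n} \<subseteq> {1..k * n}"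
  proof
    fix z assume "z \<in> induced n f g ` {1..k * n}"
    then obtain y where y: "y \<in> {1..k * n}" "z = induced n f g y" by blast
    obtain i x where ix: "i < k" "x \<in> {1..n}" "y = i * n + x"
      using block_decomposition[OF y(1)] .
    show "z \<in> {1..k * n}"
      using block_in_range[OF shift_less[OF g ix(1)] cocycle_image[OF f g ix(1,2)]]
      by (simp only: y(2) ix(3) induced_block[OF ix(1,2)])
  qed
  have inj: "inj_on (induced n f g) {1..k * n}"
  proof (rule inj_onI)
    fix y y' assume y: "y \<in> {1..k * n}" and y': "y' \<in> {1..k * n}"
      and eq: "induced n f g y = induced n f g y'"
    obtain i x where ix: "i < k" "x \<in> {1..n}" "y = i * n + x"
      using block_decomposition[OF y] .
    obtain j x' where jx: "j < k" "x' \<in> {1..n}" "y' = j * n + x'"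
      using block_decomposition[OF y'] .
    have e: "shift g i * n + f (cocycle g i) x = shift g j * n + f (cocycle g j) x'"
      using eq by (simp only: ix(3) jx(3) induced_block[OF ix(1,2)] induced_block[OF jx(1,2)])
    \<comment> \<open>Quotient and remainder of the common value in \<open>e\<close> separate the
      block index from the position inside the block.\<close>
    note c = block_coordinates[OF cocycle_image[OF f g ix(1,2)], of "shift g i"]
      and c' = block_coordinates[OF cocycle_image[OF f g jx(1,2)], of "shift g j"]
    have "shift g i = shift g j" 
      by (rule trans[OF c(1)[symmetric, unfolded e] c'(1)])
    then have ij: "i = j" by (rule shift_inj[OF g ix(1) jx(1)])
    have "f (cocycle g i) x = f (cocycle g i) x'"
      using trans[OF c(2)[symmetric, unfolded e] c'(2)] by (simp only: ij)
    moreover have "f (cocycle g i) permutes {1..n}"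
      using funcset_mem[OF f cocycle_in[OF g ix(1)]] by (simp only: sym_group_carrier)
    ultimately have "x = x'" using permutes_inj by (metis injD)
    then show "y = y'" by (simp only: ix(3) jx(3) ij)
  qed
  show "bij_betw (induced n f g) {1..k * n} {1..k * n}"
    by (rule bij_betw_imageI[OF inj endo_inj_surj[OF finite_atLeastAtMost into inj]])
qed (simp only: induced_def if_False)

lemma induced_carrier:
  assumes "f \<in> H \<rightarrow> carrier (sym_group n)"
  shows "induced n f \<in> carrier G \<rightarrow> carrier (sym_group (k * n))"
  by (intro funcsetI) (simp only: sym_group_carrier induced_permutes[OF assms])

lemma induced_comp_block:
  assumes "f \<in> H \<rightarrow> carrier (sym_group n)" "a \<in> carrier G" "b \<in> carrier G" "i < k" "x \<in> {1..n}"
  shows "(induced n f a \<circ> induced n f b) (i * n + x) =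
    shift a (shift b i) * n + f (cocycle a (shift b i)) (f (cocycle b i) x)"
  using induced_block[OF assms(4,5)] cocycle_image[OF assms(1,3-5)]
    shift_less[OF assms(3,4)] by (simp add: induced_block del: atLeastAtMost_iff)

text \<open>Multiplicativity of \<open>f\<close> turns the cocycle identity into a composition on
  each block. This later supplies the comparison homomorphisms of \<open>G\<close> in the rigid
  case.\<close>

lemma induced_hom:
  assumes "f \<in> hom (G\<lparr>carrier := H\<rparr>) (sym_group n)"
  shows "induced n f \<in> hom G (sym_group (k * n))"
proof (rule homI)
  note fD = homD_sym_group[OF assms, simplified]
  show "induced n f g \<in> carrier (sym_group (k * n))" if "g \<in> carrier G" for g
    using induced_carrier[OF fD(1)] that by blast
  fix a b assume ab: "a \<in> carrier G" "b \<in> carrier G"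
  have "induced n f (a \<otimes> b) y = (induced n f a \<circ> induced n f b) y" for y
  proof (cases "y \<in> {1..k * n}")
    case True
    then obtain i x where ix: "i < k" "x \<in> {1..n}" "y = i * n + x"
      using block_decomposition by blast
    have "f (cocycle (a \<otimes> b) i) = f (cocycle a (shift b i)) \<circ> f (cocycle b i)"
      using cocycle_mult[OF ab ix(1)] ab ix(1)
      by (simp add: fD(2) cocycle_in shift_less)
    then show ?thesis
      by (simp only: ix(3) induced_comp_block[OF fD(1) ab ix(1,2)] induced_block[OF ix(1,2)]
          shift_mult[OF ab ix(1)]) (simp only: comp_apply)
  next
    case False
    then show ?thesis by (simp add: induced_def del: atLeastAtMost_iff)
  qed
  then show "induced n f (a \<otimes> b) = induced n f a \<otimes>\<^bsub>sym_group (k * n)\<^esub> induced n f b"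
    by (auto simp: sym_group_mult)
qed

text \<open>By the cocycle identity both maps send block \<open>i\<close> to the same block, so they
  differ at \<open>(i, x)\<close> exactly when \<open>f\<close> fails multiplicativity at
  \<open>x\<close> for the corresponding pair of cocycle values.\<close>

lemma perm_dist_induced_mult:
  assumes "f \<in> H \<rightarrow> carrier (sym_group n)" "a \<in> carrier G" "b \<in> carrier G"
  shows "perm_dist (k * n) (induced n f (a \<otimes> b)) (induced n f a \<circ> induced n f b) =
    (\<Sum>i<k. perm_dist n (f (cocycle a (shift b i) \<otimes> cocycle b i))
              (f (cocycle a (shift b i)) \<circ> f (cocycle b i))) / k"
proof -
  have "{x \<in> {1..n}. induced n f (a \<otimes> b) (i * n + x) \<noteq> (induced n f a \<circ> induced n f b) (i * n + x)}
      = {x \<in> {1..n}. f (cocycle a (shift b i) \<otimes> cocycle b i) x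
           \<noteq> (f (cocycle a (shift b i)) \<circ> f (cocycle b i)) x}" if "i < k" for i
    using assms that
    by (intro Collect_cong conj_cong refl,
        simp only: induced_comp_block induced_block shift_mult cocycle_mult add_left_cancel,
        simp only: comp_apply)
  then show ?thesis
    unfolding perm_dist_def card_blocks
    by (simp add: sum_divide_distrib mult.commute divide_divide_eq_left)
qed

lemma asymptotic_hom_induced:
  assumes "asymptotic_hom (G\<lparr>carrier := H\<rparr>) n f"
  shows "asymptotic_hom G (\<lambda>l. k * n l) (\<lambda>l. induced (n l) (f l))"
proof -
  have n: "\<And>l. n l \<ge> 1" "filterlim n at_top sequentially"
    and f: "\<And>l. f l \<in> H \<rightarrow> carrier (sym_group (n l))"
    and lim: "\<And>a b. a \<in> H \<Longrightarrow> b \<in> H \<Longrightarrow>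
      (\<lambda>l. perm_dist (n l) (f l (a \<otimes> b)) (f l a \<circ> f l b)) \<longlonglongrightarrow> 0"
    using assms by (auto simp: asymptotic_hom_def sym_group_mult)
  have "(\<lambda>l. perm_dist (k * n l) (induced (n l) (f l) (a \<otimes> b))
      (induced (n l) (f l) a \<circ> induced (n l) (f l) b)) \<longlonglongrightarrow> 0"
    if ab: "a \<in> carrier G" "b \<in> carrier G" for a b
  proof -
    \<comment> \<open>The cocycle values do not depend on \<open>l\<close>, so each of the
      \<open>k\<close> summands is the defect of \<open>f l\<close> at a fixed pair in
      \<open>H\<close>.\<close>
    have "(\<lambda>l. (\<Sum>i<k. perm_dist (n l) (f l (cocycle a (shift b i) \<otimes> cocycle b i))
        (f l (cocycle a (shift b i)) \<circ> f l (cocycle b i))) / k) \<longlonglongrightarrow> (\<Sum>i<k. 0) / real k"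
      using k_pos ab by (intro tendsto_intros lim cocycle_in shift_less) auto
    then show ?thesis by (simp add: perm_dist_induced_mult[OF f ab])
  qed
  moreover have "filterlim (\<lambda>l. k * n l) at_top sequentially"
    using k_pos by (intro filterlim_at_top_mono[OF n(2)]) auto
  moreover have "k * n l \<ge> 1" for l
    using k_pos n(1)[of l] by (simp add: Suc_le_eq)
  ultimately show ?thesis
    using induced_carrier[OF f] by (auto simp: asymptotic_hom_def sym_group_mult)
qed

section \<open>Restricting a correction of an induced map\<close>

text \<open>Disagreements on block 0, where \<open>h\<close> acts as \<open>f h\<close>, are among
  all disagreements; the factor \<open>k\<close> compensates for normalising by \<open>k * n\<close>
  instead of \<open>n\<close>.\<close>

lemma perm_dist_le_induced:
  assumes "h \<in> H"
  shows "perm_dist n (f h) p \<le> real k * perm_dist (k * n) (induced n f h) p"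
proof -
  have "card {x \<in> {1..n}. f h x \<noteq> p x} = card {x \<in> {1..n}. induced n f h (0 * n + x) \<noteq> p (0 * n + x)}"
    using induced_block[OF k_pos] shift_subgroup[OF assms] cocycle_subgroup[OF assms]
    by (intro arg_cong[of _ _ card] Collect_cong conj_cong refl) simp
  also have "\<dots> \<le> card {y \<in> {1..k * n}. induced n f h y \<noteq> p y}"
    unfolding card_blocks
    using k_pos member_le_sum[of 0 "{..<k}" "\<lambda>i. card {x \<in> {1..n}. induced n f h (i * n + x) \<noteq> p (i * n + x)}"]
    by simp
  finally show ?thesis
    using k_pos by (simp add: perm_dist_def divide_right_mono)
qed

text \<open>The same \<open>\<epsilon>\<close> and \<open>N\<close> serve, with \<open>h\<close>
  restricted to \<open>H\<close>. The degree bound is regrouped by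
  \<open>k * n = n + (k - 1) * n\<close>: the blocks other than block 0 count as added
  points.\<close>

lemma correctable_if_induced:
  assumes "correctable \<nu> G (\<lambda>l. k * n l) (\<lambda>l. induced (n l) (f l))"
  shows "correctable (\<lambda>\<epsilon> n. enat ((k - 1) * n) + \<nu> \<epsilon> (k * n)) (G\<lparr>carrier := H\<rparr>) n f"
proof -
  obtain \<epsilon> :: "nat \<Rightarrow> real" and N h where \<epsilon>: "\<And>l. \<epsilon> l > 0" "\<epsilon> \<longlonglongrightarrow> 0"
    and h: "\<And>l. h l \<in> hom G (sym_group (N l))"
    and N: "\<And>l. k * n l \<le> N l" "\<And>l. enat (N l) \<le> enat (k * n l) + \<nu> (\<epsilon> l) (k * n l)"
    and lim: "\<And>g. g \<in> carrier G \<Longrightarrow>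
      (\<lambda>l. perm_dist (k * n l) (induced (n l) (f l) g) (h l g)) \<longlonglongrightarrow> 0"
    using assms unfolding correctable_def by blast
  have km: "k * m = m + (k - 1) * m" for m using k_pos by (cases k) auto
  have "h l \<in> hom (G\<lparr>carrier := H\<rparr>) (sym_group (N l))" for l
    using h[of l] H_closed by (auto simp: hom_def)
  moreover have "n l \<le> N l" for l using N(1)[of l] km[of "n l"] by linarith
  moreover have "enat (N l) \<le> enat (n l) + (enat ((k - 1) * n l) + \<nu> (\<epsilon> l) (k * n l))" for l
    using N(2)[of l] km[of "n l"] by (metis add.assoc plus_enat_simps(1))
  moreover have "(\<lambda>l. perm_dist (n l) (f l g) (h l g)) \<longlonglongrightarrow> 0" if "g \<in> H" for g
  proof (rule tendsto_sandwich[OF _ _ tendsto_const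
        tendsto_mult_right_zero[OF lim[OF H_closed[OF that]], of "real k"]])
    show "\<forall>\<^sub>F l in sequentially. 0 \<le> perm_dist (n l) (f l g) (h l g)"
      by (simp add: perm_dist_def)
    show "\<forall>\<^sub>F l in sequentially. perm_dist (n l) (f l g) (h l g)
        \<le> real k * perm_dist (k * n l) (induced (n l) (f l) g) (h l g)"
      using perm_dist_le_induced[OF that] by simp
  qed
  ultimately show ?thesis
    unfolding correctable_def using \<epsilon> by (intro exI[of _ \<epsilon>] exI[of _ N] exI[of _ h]) auto
qed

end

section \<open>Stabiliser statistics of induced maps\<close>

lemma pmf_stab_pmf:
  assumes "n \<ge> 1"
  shows "pmf (stab_pmf n f Q) s = real (card {x \<in> {1..n}. {\<gamma> \<in> Q. f \<gamma> x = x} = s}) / real n"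
proof -
  have "pmf (stab_pmf n f Q) s
      = measure (measure_pmf (pmf_of_set {1..n})) ((\<lambda>x. {\<gamma> \<in> Q. f \<gamma> x = x}) -` {s})"
    by (simp add: stab_pmf_def pmf_map)
  also have "\<dots> = real (card ({1..n} \<inter> (\<lambda>x. {\<gamma> \<in> Q. f \<gamma> x = x}) -` {s})) / real n"
    using assms by (subst measure_pmf_of_set) auto
  finally show ?thesis by (simp add: Int_def vimage_def)
qed

lemma tv_dist_nonneg: "0 \<le> tv_dist \<Omega> p q"
  by (simp add: tv_dist_def sum_nonneg)

lemma pmf_map_pmf_sum:
  assumes "finite A" "set_pmf p \<subseteq> A"
  shows "pmf (map_pmf \<phi> p) s = (\<Sum>S | S \<in> A \<and> \<phi> S = s. pmf p S)"
proof -
  \<comment> \<open>The fibre may be infinite; cutting it down to \<open>A\<close> discards only a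
    null set.\<close>
  have "pmf (map_pmf \<phi> p) s = measure (measure_pmf p) (\<phi> -` {s} \<inter> A)"
    unfolding pmf_map using assms by (intro measure_eq_AE) (auto simp: AE_measure_pmf_iff)
  also have "\<dots> = sum (pmf p) (\<phi> -` {s} \<inter> A)"
    using assms by (intro measure_measure_pmf_finite) auto
  also have "\<phi> -` {s} \<inter> A = {S. S \<in> A \<and> \<phi> S = s}" by auto
  finally show ?thesis .
qed

text \<open>The fibres of \<open>\<phi>\<close> partition \<open>A\<close>, and the triangle
  inequality applies on each fibre.\<close>

lemma tv_dist_map_pmf_le:
  assumes "finite A" "finite B" "set_pmf p \<subseteq> A" "set_pmf q \<subseteq> A" "\<phi> ` A \<subseteq> B"
  shows "tv_dist B (map_pmf \<phi> p) (map_pmf \<phi> q) \<le> tv_dist A p q"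
proof -
  have "(\<Sum>s\<in>B. \<bar>pmf (map_pmf \<phi> p) s - pmf (map_pmf \<phi> q) s\<bar>)
      = (\<Sum>s\<in>B. \<bar>\<Sum>S | S \<in> A \<and> \<phi> S = s. pmf p S - pmf q S\<bar>)"
    using assms by (simp add: pmf_map_pmf_sum sum_subtractf)
  also have "\<dots> \<le> (\<Sum>s\<in>B. \<Sum>S | S \<in> A \<and> \<phi> S = s. \<bar>pmf p S - pmf q S\<bar>)"
    by (intro sum_mono sum_abs)
  also have "\<dots> = (\<Sum>S\<in>A. \<bar>pmf p S - pmf q S\<bar>)"
    using assms by (intro sum.group) auto
  finally show ?thesis by (simp add: tv_dist_def)
qed

lemma set_stab_pmf: "set_pmf (stab_pmf n f Q) \<subseteq> Pow Q"
  by (auto simp: stab_pmf_def)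

context left_transversal
begin

text \<open>The elements of \<open>H\<close> that decide which members of \<open>Q\<close> fix a
  point of block \<open>i\<close>.\<close>

definition conj_part :: "nat \<Rightarrow> 'a set \<Rightarrow> 'a set" where
  "conj_part i Q = {h \<in> H. \<exists>\<gamma>\<in>Q. h = inv (t i) \<otimes> (\<gamma> \<otimes> t i)}"

text \<open>Translates a stabiliser pattern of \<open>f\<close> on \<open>conj_part i Q\<close> back
  into a pattern on \<open>Q\<close>.\<close>

definition conj_pull :: "nat \<Rightarrow> 'a set \<Rightarrow> 'a set \<Rightarrow> 'a set" where
  "conj_pull i Q S = {\<gamma> \<in> Q. inv (t i) \<otimes> (\<gamma> \<otimes> t i) \<in> S}"

lemma finite_conj_part: "finite Q \<Longrightarrow> finite (conj_part i Q)"
  by (rule finite_subset[of _ "(\<lambda>\<gamma>. inv (t i) \<otimes> (\<gamma> \<otimes> t i)) ` Q"]) (auto simp: conj_part_def)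

text \<open>An element fixes \<open>(i, x)\<close> iff it preserves block \<open>i\<close>, meaning
  that its conjugate by \<open>t i\<close> lies in \<open>H\<close>, and this conjugate, which is
  then the cocycle value, fixes \<open>x\<close> under \<open>f\<close>.\<close>

lemma induced_stabiliser_block:
  assumes "f \<in> H \<rightarrow> carrier (sym_group n)" "Q \<subseteq> carrier G" "i < k" "x \<in> {1..n}"
  shows "{\<gamma> \<in> Q. induced n f \<gamma> (i * n + x) = i * n + x} =
    conj_pull i Q {h \<in> conj_part i Q. f h x = x}"
proof -
  have "induced n f \<gamma> (i * n + x) = i * n + x \<longleftrightarrow>
      inv (t i) \<otimes> (\<gamma> \<otimes> t i) \<in> H \<and> f (inv (t i) \<otimes> (\<gamma> \<otimes> t i)) x = x" if "\<gamma> \<in> Q" for \<gamma>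
  proof -
    have g: "\<gamma> \<in> carrier G" using that assms by blast
    have "induced n f \<gamma> (i * n + x) = i * n + x \<longleftrightarrow> shift \<gamma> i = i \<and> f (cocycle \<gamma> i) x = x"
      using block_coordinates[OF cocycle_image[OF assms(1) g assms(3,4)], of "shift \<gamma> i"]
        block_coordinates[OF assms(4), of i] induced_block[OF assms(3,4)] by metis
    also have "\<dots> \<longleftrightarrow> shift \<gamma> i = i \<and> f (inv (t i) \<otimes> (\<gamma> \<otimes> t i)) x = x"
      by (auto simp: cocycle_def)
    finally show ?thesis using shift_eq_self_iff[OF g assms(3)] by simp
  qed
  then show ?thesis by (auto simp: conj_pull_def conj_part_def)
qed

text \<open>A uniform point of \<open>{1..k * n}\<close> is a uniform block together with a uniform
  point inside it, hence a mixture with weights \<open>1 / k\<close>.\<close>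

lemma pmf_stab_pmf_induced:
  assumes "f \<in> H \<rightarrow> carrier (sym_group n)" "Q \<subseteq> carrier G" "n \<ge> 1"
  shows "pmf (stab_pmf (k * n) (induced n f) Q) s =
    (\<Sum>i<k. pmf (map_pmf (conj_pull i Q) (stab_pmf n f (conj_part i Q))) s) / k"
proof -
  have kn: "k * n \<ge> 1" using k_pos assms(3) by (simp add: Suc_le_eq)
  have "pmf (map_pmf (conj_pull i Q) (stab_pmf n f (conj_part i Q))) s =
      real (card {x \<in> {1..n}. {\<gamma> \<in> Q. induced n f \<gamma> (i * n + x) = i * n + x} = s}) / n"
    if "i < k" for i
  proof -
    let ?\<psi> = "\<lambda>x. conj_pull i Q {h \<in> conj_part i Q. f h x = x}"
    have "pmf (map_pmf (conj_pull i Q) (stab_pmf n f (conj_part i Q))) s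
        = measure (measure_pmf (pmf_of_set {1..n})) (?\<psi> -` {s})"
      by (simp add: stab_pmf_def pmf.map_comp pmf_map comp_def)
    also have "\<dots> = real (card ({1..n} \<inter> ?\<psi> -` {s})) / n"
      using assms by (subst measure_pmf_of_set) auto
    also have "{1..n} \<inter> ?\<psi> -` {s} =
        {x \<in> {1..n}. {\<gamma> \<in> Q. induced n f \<gamma> (i * n + x) = i * n + x} = s}"
      using induced_stabiliser_block[OF assms(1,2) that] by blast
    finally show ?thesis .
  qed
  then show ?thesis
    unfolding pmf_stab_pmf[OF kn] card_blocks
    by (simp add: sum_divide_distrib mult.commute divide_divide_eq_left)
qed

text \<open>The triangle inequality bounds the distance of two mixtures by the average distance of
  their components; \<open>tv_dist_map_pmf_le\<close> then removes \<open>conj_pull\<close>.\<close>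

lemma tv_dist_induced_le:
  assumes "f \<in> H \<rightarrow> carrier (sym_group n)" "f' \<in> H \<rightarrow> carrier (sym_group n)"
    "finite Q" "Q \<subseteq> carrier G" "n \<ge> 1"
  shows "tv_dist (Pow Q) (stab_pmf (k * n) (induced n f) Q) (stab_pmf (k * n) (induced n f') Q) \<le>
    (\<Sum>i<k. tv_dist (Pow (conj_part i Q)) (stab_pmf n f (conj_part i Q))
              (stab_pmf n f' (conj_part i Q))) / k"
proof -
  define p where "p i = map_pmf (conj_pull i Q) (stab_pmf n f (conj_part i Q))" for i
  define q where "q i = map_pmf (conj_pull i Q) (stab_pmf n f' (conj_part i Q))" for i
  have "tv_dist (Pow Q) (stab_pmf (k * n) (induced n f) Q) (stab_pmf (k * n) (induced n f') Q)
      = (\<Sum>s\<in>Pow Q. \<bar>\<Sum>i<k. pmf (p i) s - pmf (q i) s\<bar>) / k / 2"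
    using assms unfolding tv_dist_def p_def q_def
    by (simp add: pmf_stab_pmf_induced sum_subtractf flip: diff_divide_distrib sum_divide_distrib)
  also have "\<dots> \<le> (\<Sum>s\<in>Pow Q. \<Sum>i<k. \<bar>pmf (p i) s - pmf (q i) s\<bar>) / k / 2"
    by (intro divide_right_mono sum_mono sum_abs) auto
  also have "\<dots> = (\<Sum>i<k. tv_dist (Pow Q) (p i) (q i)) / k"
    by (subst sum.swap) (simp add: tv_dist_def sum_divide_distrib mult.commute)
  also have "\<dots> \<le> (\<Sum>i<k. tv_dist (Pow (conj_part i Q)) (stab_pmf n f (conj_part i Q))
              (stab_pmf n f' (conj_part i Q))) / k"
    unfolding p_def q_def using assms finite_conj_part
    by (intro divide_right_mono sum_mono tv_dist_map_pmf_le set_stab_pmf) (auto simp: conj_pull_def)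
  finally show ?thesis .
qed

section \<open>Passage of stability and rigidity to \<open>H\<close>\<close>

lemma flexibly_stable_subgroup:
  assumes "flexibly_stable \<nu> G"
  shows "flexibly_stable (\<lambda>\<epsilon> n. enat ((k - 1) * n) + \<nu> \<epsilon> (k * n)) (G\<lparr>carrier := H\<rparr>)"
  unfolding flexibly_stable_def
  by (intro allI impI correctable_if_induced
      assms[unfolded flexibly_stable_def, rule_format] asymptotic_hom_induced)

lemma flexibly_BS_rigid_subgroup:
  assumes rigid: "flexibly_BS_rigid \<nu> G"
  shows "flexibly_BS_rigid (\<lambda>\<epsilon> n. enat ((k - 1) * n) + \<nu> \<epsilon> (k * n)) (G\<lparr>carrier := H\<rparr>)"
  unfolding flexibly_BS_rigid_def
proof (intro allI impI, elim exE conjE)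
  fix n f g
  assume ah: "asymptotic_hom (G\<lparr>carrier := H\<rparr>) n f"
    and g: "\<forall>l. g l \<in> hom (G\<lparr>carrier := H\<rparr>) (sym_group (n l))"
    and tv: "\<forall>Q. finite Q \<and> Q \<subseteq> carrier (G\<lparr>carrier := H\<rparr>) \<longrightarrow>
      (\<lambda>l. tv_dist (Pow Q) (stab_pmf (n l) (f l) Q) (stab_pmf (n l) (g l) Q)) \<longlonglongrightarrow> 0"
  have n: "\<And>l. n l \<ge> 1" and f: "\<And>l. f l \<in> H \<rightarrow> carrier (sym_group (n l))"
    using ah by (auto simp: asymptotic_hom_def)
  have g': "\<And>l. g l \<in> H \<rightarrow> carrier (sym_group (n l))"
    using g by (auto simp: hom_def)
  have "(\<lambda>l. tv_dist (Pow Q) (stab_pmf (k * n l) (induced (n l) (f l)) Q)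
      (stab_pmf (k * n l) (induced (n l) (g l)) Q)) \<longlonglongrightarrow> 0"
    if Q: "finite Q" "Q \<subseteq> carrier G" for Q
  proof -
    \<comment> \<open>For fixed \<open>Q\<close> the sets \<open>conj_part i Q\<close> are finite
      subsets of \<open>H\<close> independent of \<open>l\<close>, so the hypothesis on
      \<open>f\<close> and \<open>g\<close> applies to each.\<close>
    let ?d = "\<lambda>i l. tv_dist (Pow (conj_part i Q)) (stab_pmf (n l) (f l) (conj_part i Q))
        (stab_pmf (n l) (g l) (conj_part i Q))"
    have part: "?d i \<longlonglongrightarrow> 0" for i
      using tv finite_conj_part[OF Q(1)] by (auto simp: conj_part_def)
    have "(\<lambda>l. (\<Sum>i<k. ?d i l) / k) \<longlonglongrightarrow> (\<Sum>i<k. 0) / real k"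
      using k_pos by (intro tendsto_intros part) auto
    then have "(\<lambda>l. (\<Sum>i<k. ?d i l) / k) \<longlonglongrightarrow> 0" by simp
    then show ?thesis
      by (rule tendsto_sandwich[OF _ _ tendsto_const, rotated 2])
        (auto intro!: always_eventually tv_dist_nonneg tv_dist_induced_le[OF f g' Q n])
  qed
  then have "correctable \<nu> G (\<lambda>l. k * n l) (\<lambda>l. induced (n l) (f l))"
    using induced_hom g
    by (intro rigid[unfolded flexibly_BS_rigid_def, rule_format, OF asymptotic_hom_induced[OF ah]]
        exI[of _ "\<lambda>l. induced (n l) (g l)"]) simp
  then show "correctable (\<lambda>\<epsilon> n. enat ((k - 1) * n) + \<nu> \<epsilon> (k * n)) (G\<lparr>carrier := H\<rparr>) n f"
    by (rule correctable_if_induced)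
qed

end

section \<open>Existence of a normalised left transversal\<close>

lemma (in group) left_transversal_exists:
  assumes H: "subgroup H G" and fin: "finite (rcosets H)"
  obtains t where "left_transversal G H (card (rcosets H)) t"
proof -
  let ?k = "card (rcosets H)"
  have HR: "H \<in> rcosets H" by (rule subgroup.subgroup_in_rcosets[OF H group_axioms])
  then have k: "0 < ?k" using fin card_gt_0_iff by blast
  obtain b0 where b0: "bij_betw b0 {..<?k} (rcosets H)"
    using ex_bij_betw_nat_finite[OF fin] unfolding atLeast0LessThan by blast
  have "H \<in> b0 ` {..<?k}" using HR by (simp only: bij_betw_imp_surj_on[OF b0])
  then obtain m where m: "m < ?k" "b0 m = H" by (metis imageE lessThan_iff)
  \<comment> \<open>Swapping the indices 0 and \<open>m\<close> gives \<open>H\<close> itself index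
    0, so that \<open>r 0\<close> can be chosen as the identity.\<close>
  define b where "b = b0 \<circ> Transposition.transpose 0 m"
  have b: "bij_betw b {..<?k} (rcosets H)"
    unfolding b_def using m k
    by (intro bij_betw_trans[OF _ b0] permutes_imp_bij permutes_swap_id) auto
  have b0H: "b 0 = H" by (simp add: b_def m)
  have "\<exists>r. r \<in> carrier G \<and> b i = H #> r \<and> (i = 0 \<longrightarrow> r = \<one>)" if "i < ?k" for i
  proof (cases "i = 0")
    case True
    then show ?thesis using b0H coset_mult_one[OF subgroup.subset[OF H]] by auto
  next
    case False
    have "b i \<in> rcosets H" using that by (intro bij_betw_apply[OF b]) simp
    then show ?thesis using False by (auto simp: RCOSETS_def)
  qed
  then obtain r where r: "\<And>i. i < ?k \<Longrightarrow> r i \<in> carrier G" "\<And>i. i < ?k \<Longrightarrow> b i = H #> r i"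
    "r 0 = \<one>" using k by metis
  \<comment> \<open>Inversion exchanges right and left cosets, so inverses of right representatives
    form a left transversal. Both sides say \<open>r i \<otimes> g \<in> H\<close>; the index
    belonging to \<open>g\<close> is that of the right coset of \<open>inv g\<close>.\<close>
  have iff: "inv (inv (r i)) \<otimes> g \<in> H \<longleftrightarrow> b i = H #> inv g"
    if "g \<in> carrier G" "i < ?k" for g i
  proof -
    note rc = r(1)[OF that(2)] and ic = inv_closed[OF that(1)] and subset = subgroup.subset[OF H]
    note iic = inv_closed[OF ic]
    have "H #> r i = H #> inv g \<longleftrightarrow> r i \<otimes> inv (inv g) \<in> H"
    proof
      assume "H #> r i = H #> inv g"
      then show "r i \<otimes> inv (inv g) \<in> H"
        by (rule coset_join1[OF coset_mult_inv2[OF _ rc ic subset] m_closed[OF rc iic] H])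
    next
      assume "r i \<otimes> inv (inv g) \<in> H"
      then show "H #> r i = H #> inv g"
        by (rule coset_mult_inv1[OF coset_join2[OF m_closed[OF rc iic] H] rc ic subset])
    qed
    then show ?thesis using that r(1,2) by simp
  qed
  have "\<exists>!i. i < ?k \<and> inv (inv (r i)) \<otimes> g \<in> H" if g: "g \<in> carrier G" for g
  proof -
    have "H #> inv g \<in> rcosets H"
      using g by (intro rcosetsI subgroup.subset[OF H]) auto
    then have "H #> inv g \<in> b ` {..<?k}"
      by (simp only: bij_betw_imp_surj_on[OF b])
    then obtain i where i: "i < ?k" "b i = H #> inv g" by (metis imageE lessThan_iff)
    show ?thesis
    proof (rule ex1I[of _ i])
      show "i < ?k \<and> inv (inv (r i)) \<otimes> g \<in> H" using iff[OF g i(1)] i by blast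
    next
      fix j assume j: "j < ?k \<and> inv (inv (r j)) \<otimes> g \<in> H"
      then have "b j = b i" using iff[OF g] i(2) by metis
      then show "j = i" using i(1) j by (intro inj_onD[OF bij_betw_imp_inj_on[OF b]]) auto
    qed
  qed
  moreover have "inv (r 0) = \<one>" by (simp only: r(3) inv_one)
  ultimately have "left_transversal_axioms G H ?k (\<lambda>i. inv (r i))"
    by (intro left_transversal_axioms.intro[OF H k inv_closed[OF r(1)]])
  from that[OF left_transversal.intro[OF group_axioms this]] show ?thesis .
qed

theorem proposition1p25:
  fixes \<Gamma> :: "('a, 'b) monoid_scheme" and H :: "'a set" and \<nu> :: "real \<Rightarrow> nat \<Rightarrow> enat"
  assumes "group \<Gamma>"
    and "subgroup H \<Gamma>"
    and "finite (rcosets\<^bsub>\<Gamma>\<^esub> H)"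
    and "\<And>n. n \<ge> 1 \<Longrightarrow> mono_on {0<..} (\<lambda>\<epsilon>. \<nu> \<epsilon> n)"
  shows "let \<nu>' = (\<lambda>\<epsilon> n. enat ((group_index \<Gamma> H - 1) * n) + \<nu> \<epsilon> (group_index \<Gamma> H * n)) in
         (flexibly_stable \<nu> \<Gamma> \<longrightarrow> flexibly_stable \<nu>' (\<Gamma>\<lparr>carrier := H\<rparr>)) \<and>
         (flexibly_BS_rigid \<nu> \<Gamma> \<longrightarrow> flexibly_BS_rigid \<nu>' (\<Gamma>\<lparr>carrier := H\<rparr>))"
proof -
  obtain t where t: "left_transversal \<Gamma> H (group_index \<Gamma> H) t"
    using group.left_transversal_exists[OF assms(1-3)] unfolding group_index_def .
  show ?thesis
    unfolding Let_def
    by (intro conjI impI left_transversal.flexibly_stable_subgroup[OF t]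
        left_transversal.flexibly_BS_rigid_subgroup[OF t])
qed

end
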